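(* Let $(X,\mathcal{S})$ be an $S$-metric space, let $f:X\to X$ be a self-mapping, let $\zeta\in\mathcal{Z}$ be a simulation function, let $0\le a<1$ be the number used in the definition of $M_S(x,y)$, and let $\mu=\inf\{\mathcal{S}(x,x,fx): x\neq fx,\ x\in X\}$. Suppose there exist points $x_1,x_2\in X$ such that (a) for all $x\in E_\mu^S(x_1,x_2)$ there exists $\delta(\mu)>0$ satisfying $$\frac{\mu}{2}\le M_S(x,x_1)+M_S(x,x_2)<\frac{\mu}{2}+\delta(\mu)\ \Longrightarrow\ \mathcal{S}(fx,fx,x_1)+\mathcal{S}(fx,fx,x_2)\le\mu;$$ (b) for all $x\in X$, $$\mathcal{S}(fx,fx,x)>0\ \Longrightarrow\ \zeta\big(\mathcal{S}(fx,fx,x),M_S(x,x_1)\big)\ge 0\ \text{ and }\ \zeta\big(\mathcal{S}(fx,fx,x),M_S(x,x_2)\big)\ge 0;$$ (c) for all $x\in X$, $$\mathcal{S}(fx,fx,x)>0\ \Longrightarrow\ \zeta\left(\mathcal{S}(fx,fx,x),\frac{\mathcal{S}(x,x,x_1)+\mathcal{S}(fx,fx,x_1)+\mathcal{S}(x,x,x_2)+\mathcal{S}(fx,fx,x_2)}{2}\right)\ge 0.$$ Then $fx_1=x_1$, $fx_2=x_2$, and $Fix(f)$ contains the ellipse $E_\mu^S(x_1,x_2)$.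
   Context: An $S$-metric on a nonempty set $X$ is a function $\mathcal{S}:X^3\to[0,\infty)$ such that for all $x,y,z,a\in X$: (1) $\mathcal{S}(x,y,z)=0$ if and only if $x=y=z$; (2) $\mathcal{S}(x,y,z)\le\mathcal{S}(x,x,a)+\mathcal{S}(y,y,a)+\mathcal{S}(z,z,a)$. Then $(X,\mathcal{S})$ is an $S$-metric space; it satisfies $\mathcal{S}(x,x,y)=\mathcal{S}(y,y,x)$ for all $x,y\in X$. $\mathcal{Z}$ is the set of simulation functions: functions $\zeta:[0,\infty)\times[0,\infty)\to\mathbb{R}$ such that ($\zeta_1$) $\zeta(0,0)=0$; ($\zeta_2$) $\zeta(t,s)<s-t$ for all $s,t>0$; ($\zeta_3$) if $\{t_n\},\{s_n\}$ are sequences in $(0,\infty)$ with $\lim_{n\to\infty}t_n=\lim_{n\to\infty}s_n>0$, then $\limsup_{n\to\infty}\zeta(t_n,s_n)<0$. Write $fx=f(x)$ and $Fix(f)=\{x\in X: fx=x\}$. For a fixed number $0\le a<1$, $$M_S(x,y)=\max\left\{a\mathcal{S}(x,x,fx)+(1-a)\mathcal{S}(y,y,fy),\ (1-a)\mathcal{S}(x,x,fx)+a\mathcal{S}(y,y,fy),\ \frac{\mathcal{S}(x,x,fy)+\mathcal{S}(y,y,fx)}{4}\right\}.$$ For $x_1,x_2\in X$ and $r\in[0,\infty)$, the ellipse is $E_r^S(x_1,x_2)=\{x\in X:\mathcal{S}(x,x,x_1)+\mathcal{S}(x,x,x_2)=r\}$. *)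

theory Defs
  imports Complex_Main "HOL-Library.Extended_Real" "HOL-Library.FuncSet"
begin

locale S_metric_space =
  fixes X :: "'a set" and S :: "'a \<Rightarrow> 'a \<Rightarrow> 'a \<Rightarrow> real"
  assumes nonempty: "X \<noteq> {}"
    and nonneg: "\<lbrakk>x \<in> X; y \<in> X; z \<in> X\<rbrakk> \<Longrightarrow> 0 \<le> S x y z"
    and zero_iff: "\<lbrakk>x \<in> X; y \<in> X; z \<in> X\<rbrakk> \<Longrightarrow> S x y z = 0 \<longleftrightarrow> x = y \<and> y = z"
    and rectangle: "\<lbrakk>x \<in> X; y \<in> X; z \<in> X; a \<in> X\<rbrakk>
      \<Longrightarrow> S x y z \<le> S x x a + S y y a + S z z a"

text \<open>Simulation functions have domain \<open>[0,\<infinity>) \<times> [0,\<infinity>)\<close>; values of \<open>\<zeta>\<close> at negative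
  arguments are unconstrained and irrelevant. The limit superior may be \<open>-\<infinity>\<close>, so it is
  taken in the extended reals.\<close>

definition simulation_function :: "(real \<Rightarrow> real \<Rightarrow> real) \<Rightarrow> bool" where
  "simulation_function \<zeta> \<longleftrightarrow>
     \<zeta> 0 0 = 0 \<and>
     (\<forall>t>0. \<forall>s>0. \<zeta> t s < s - t) \<and>
     (\<forall>(t :: nat \<Rightarrow> real) (s :: nat \<Rightarrow> real) l.
        (\<forall>n. 0 < t n) \<longrightarrow> (\<forall>n. 0 < s n) \<longrightarrow> t \<longlonglongrightarrow> l \<longrightarrow> s \<longlonglongrightarrow> l \<longrightarrow> 0 < l \<longrightarrow>
        limsup (\<lambda>n. ereal (\<zeta> (t n) (s n))) < 0)"

definition Fix :: "'a set \<Rightarrow> ('a \<Rightarrow> 'a) \<Rightarrow> 'a set" where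
  "Fix X f = {x \<in> X. f x = x}"

definition M_S :: "('a \<Rightarrow> 'a \<Rightarrow> 'a \<Rightarrow> real) \<Rightarrow> ('a \<Rightarrow> 'a) \<Rightarrow> real \<Rightarrow> 'a \<Rightarrow> 'a \<Rightarrow> real" where
  "M_S S f a x y = Max {a * S x x (f x) + (1 - a) * S y y (f y),
                        (1 - a) * S x x (f x) + a * S y y (f y),
                        (S x x (f y) + S y y (f x)) / 4}"

definition ellipse :: "'a set \<Rightarrow> ('a \<Rightarrow> 'a \<Rightarrow> 'a \<Rightarrow> real) \<Rightarrow> real \<Rightarrow> 'a \<Rightarrow> 'a \<Rightarrow> 'a set" where
  "ellipse X S r x1 x2 = {x \<in> X. S x x x1 + S x x x2 = r}"

text \<open>If \<open>f\<close> is the identity on \<open>X\<close>, the set below is empty and the value is an unspecified real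
  number instead of \<open>\<infinity>\<close>; every point of \<open>X\<close> is then fixed.\<close>

definition min_displacement :: "'a set \<Rightarrow> ('a \<Rightarrow> 'a \<Rightarrow> 'a \<Rightarrow> real) \<Rightarrow> ('a \<Rightarrow> 'a) \<Rightarrow> real" where
  "min_displacement X S f = Inf {S x x (f x) |x. x \<in> X \<and> x \<noteq> f x}"

end

theory Submission
  imports Defs
begin

text \<open>Since \<open>\<zeta> t s < s - t\<close>, condition (b) says that a point \<open>x\<close> moved by \<open>f\<close> satisfies
  \<open>S x x (f x) < M_S x x\<^sub>i\<close>. For \<open>x = x\<^sub>i\<close> the right-hand side equals the left-hand side, so
  \<open>x\<^sub>i\<close> is fixed. For \<open>x\<close> on the ellipse put \<open>d = S x x (f x)\<close>. The terms of \<open>M_S x x\<^sub>i\<close> weighted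
  by \<open>a\<close> and \<open>1 - a\<close> are at most \<open>d\<close>, so \<open>4 d < S x x x\<^sub>i + S (f x) (f x) x\<^sub>i\<close>,
  which the rectangle inequality bounds by \<open>d + 3 S x x x\<^sub>i\<close>. Hence \<open>d < S x x x\<^sub>i\<close>, and
  adding over \<open>i = 1, 2\<close> gives \<open>2 d < \<mu>\<close>, contradicting
  \<open>\<mu> \<le> d\<close>.\<close>

lemma simulation_function_nonneg_imp_less:
  assumes "simulation_function \<zeta>" "0 \<le> \<zeta> t s" "0 < t" "0 < s"
  shows "t < s"
  using assms unfolding simulation_function_def by fastforce

context S_metric_space
begin

lemma self_zero: "x \<in> X \<Longrightarrow> S x x x = 0"
  by (simp add: zero_iff)

lemma pos: "\<lbrakk>x \<in> X; y \<in> X; x \<noteq> y\<rbrakk> \<Longrightarrow> 0 < S x x y"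
  using nonneg[of x x y] zero_iff[of x x y] by fastforce

text \<open>With the auxiliary point equal to the repeated argument, two of the three bounding terms
  vanish; this works in both directions.\<close>

lemma sym: "\<lbrakk>x \<in> X; y \<in> X\<rbrakk> \<Longrightarrow> S x x y = S y y x"
  using rectangle[of x x y x] rectangle[of y y x y] self_zero[of x] self_zero[of y] by simp

lemma rectangle2: "\<lbrakk>x \<in> X; y \<in> X; z \<in> X\<rbrakk> \<Longrightarrow> S x x z \<le> 2 * S x x y + S z z y"
  using rectangle[of x x z y] by simp

lemma min_displacement_le:
  assumes "f \<in> X \<rightarrow> X" "x \<in> X" "f x \<noteq> x"
  shows "min_displacement X S f \<le> S x x (f x)"
  unfolding min_displacement_def
proof (rule cInf_lower)
  show "bdd_below {S x x (f x) |x. x \<in> X \<and> x \<noteq> f x}"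
    using assms(1) nonneg by (intro bdd_belowI[of _ 0]) auto
qed (use assms in force)

text \<open>The weights \<open>a\<close> and \<open>1 - a\<close> sum to 1, and the third term is
  only half of \<open>S x x (f x)\<close>.\<close>

lemma M_S_self: "x \<in> X \<Longrightarrow> f x \<in> X \<Longrightarrow> M_S S f a x x = S x x (f x)"
  using nonneg[of x x "f x"] by (simp add: M_S_def algebra_simps)

lemma M_S_fixed:
  assumes "p \<in> X" "f p = p"
  shows "M_S S f a x p =
    Max {a * S x x (f x), (1 - a) * S x x (f x), (S x x p + S p p (f x)) / 4}"
  using assms by (simp add: M_S_def self_zero)

lemma simulation_center_fixed:
  assumes "simulation_function \<zeta>" "f \<in> X \<rightarrow> X" "p \<in> X"
    and \<zeta>: "0 < S (f p) (f p) p \<Longrightarrow> 0 \<le> \<zeta> (S (f p) (f p) p) (M_S S f a p p)"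
  shows "f p = p"
proof (rule ccontr)
  assume ne: "f p \<noteq> p"
  have fp: "f p \<in> X" using assms(2,3) by auto
  have d: "0 < S (f p) (f p) p" using pos fp assms(3) ne by simp
  have "M_S S f a p p = S (f p) (f p) p"
    using M_S_self sym assms(3) fp by simp
  with simulation_function_nonneg_imp_less[OF assms(1) \<zeta>[OF d]] d show False by simp
qed

lemma simulation_displacement_bound:
  assumes "simulation_function \<zeta>" "0 \<le> a" "a < 1" "x \<in> X" "f x \<in> X" "f x \<noteq> x"
    and p: "p \<in> X" "f p = p"
    and \<zeta>: "0 \<le> \<zeta> (S (f x) (f x) x) (M_S S f a x p)"
  shows "S x x (f x) < S x x p"
proof -
  let ?d = "S x x (f x)"
  have d: "0 < ?d" using pos assms(4-6) by metis
  have dd: "S (f x) (f x) x = ?d" using sym assms(4,5) by simp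
  \<comment> \<open>The bound from \<zeta> requires a positive second argument. The weight
    \<open>1 - a\<close> is positive even when \<open>a = 0\<close>.\<close>
  have "(1 - a) * ?d \<le> M_S S f a x p" by (simp add: M_S_fixed[where f = f, OF p])
  moreover have "0 < (1 - a) * ?d" using d assms(3) by simp
  ultimately have "?d < M_S S f a x p"
    using simulation_function_nonneg_imp_less[OF assms(1) \<zeta>] d dd by simp
  moreover have "a * ?d \<le> ?d" "(1 - a) * ?d \<le> ?d"
    using d assms(2,3) by (simp_all add: mult_le_cancel_right1)
  ultimately have "4 * ?d < S x x p + S p p (f x)"
    by (auto simp: M_S_fixed[where f = f, OF p] less_max_iff_disj)
  moreover have "S p p (f x) \<le> 2 * S p p x + ?d"
    using rectangle2[of p x "f x"] p(1) assms(4,5) dd by simp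
  ultimately show ?thesis
    using sym[of p x] p(1) assms(4) d by simp
qed

end

theorem theorem2p7:
  fixes X :: "'a set" and S :: "'a \<Rightarrow> 'a \<Rightarrow> 'a \<Rightarrow> real" and f :: "'a \<Rightarrow> 'a"
    and \<zeta> :: "real \<Rightarrow> real \<Rightarrow> real" and a \<mu> :: real and x1 x2 :: 'a
  assumes "S_metric_space X S"
    and "f \<in> X \<rightarrow> X"
    and "simulation_function \<zeta>"
    and "0 \<le> a" and "a < 1"
    and "\<mu> = min_displacement X S f"
    and "x1 \<in> X" and "x2 \<in> X"
    and a: "\<forall>x\<in>ellipse X S \<mu> x1 x2. \<exists>\<delta>>0.
      \<mu> / 2 \<le> M_S S f a x x1 + M_S S f a x x2 \<and>
      M_S S f a x x1 + M_S S f a x x2 < \<mu> / 2 + \<delta> \<longrightarrow>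
      S (f x) (f x) x1 + S (f x) (f x) x2 \<le> \<mu>"
    and b: "\<forall>x\<in>X. S (f x) (f x) x > 0 \<longrightarrow>
      \<zeta> (S (f x) (f x) x) (M_S S f a x x1) \<ge> 0 \<and>
      \<zeta> (S (f x) (f x) x) (M_S S f a x x2) \<ge> 0"
    and c: "\<forall>x\<in>X. S (f x) (f x) x > 0 \<longrightarrow>
      \<zeta> (S (f x) (f x) x)
        ((S x x x1 + S (f x) (f x) x1 + S x x x2 + S (f x) (f x) x2) / 2) \<ge> 0"
  shows "f x1 = x1 \<and> f x2 = x2 \<and> ellipse X S \<mu> x1 x2 \<subseteq> Fix X f"
proof -
  interpret S_metric_space X S by fact
  have f: "f \<in> X \<rightarrow> X" by fact
  have fix1: "f x1 = x1" and fix2: "f x2 = x2"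
    using simulation_center_fixed[OF assms(3) f] \<open>x1 \<in> X\<close> \<open>x2 \<in> X\<close> b by blast+
  have "f x = x" if "x \<in> X" and x: "S x x x1 + S x x x2 = \<mu>" for x
  proof (rule ccontr)
    assume ne: "f x \<noteq> x"
    have fx: "f x \<in> X" using f \<open>x \<in> X\<close> by auto
    have "0 < S (f x) (f x) x" using pos fx \<open>x \<in> X\<close> ne by simp
    then have "S x x (f x) < S x x x1" "S x x (f x) < S x x x2"
      using b \<open>x \<in> X\<close> simulation_displacement_bound[where f = f, OF assms(3-5) \<open>x \<in> X\<close> fx ne]
        fix1 fix2 \<open>x1 \<in> X\<close> \<open>x2 \<in> X\<close> by blast+
    \<comment> \<open>The moved point \<open>x\<close> makes the set under the infimum nonempty, so
      the unspecified value of \<open>Inf\<close> does not arise.\<close>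
    moreover have "\<mu> \<le> S x x (f x)"
      using min_displacement_le[OF f \<open>x \<in> X\<close> ne] assms(6) by simp
    \<comment> \<open>The estimates \<open>2 * d < \<mu>\<close> and \<open>\<mu> \<le> d\<close>
      for the displacement \<open>d\<close> only force \<open>d < 0\<close>; its sign gives the
      contradiction.\<close>
    moreover have "0 \<le> S x x (f x)" using nonneg \<open>x \<in> X\<close> fx by simp
    ultimately show False using x by linarith
  qed
  then show ?thesis
    using fix1 fix2 by (auto simp: ellipse_def Fix_def)
qed

end
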